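(* Let $R$ be a Dedekind domain with field of fractions $K$, let $n\ge 1$ be an integer, let $\underline{S}\subseteq R^n$ be an arbitrary subset, and let $\mathbf{m}\in\mathbb{W}^n$, $k\in\mathbb{W}$. Let $f\in R[\underline{x}]$ be a primitive polynomial of type $(\mathbf{m},k)$. Then $d(\underline{S},f)$ divides $\Gamma_{\mathbf{m},k}(\underline{S})$, and this is sharp, i.e. there exists a primitive polynomial $g\in R[\underline{x}]$ of type $(\mathbf{m},k)$ such that $d(\underline{S},g)=\Gamma_{\mathbf{m},k}(\underline{S})$.
   Context: $\mathbb{W}$ is the set of non-negative integers; $\underline{x}=(x_1,\dots,x_n)$. A polynomial in $R[\underline{x}]$ is primitive if its coefficients generate the unit ideal. For $f\in K[\underline{x}]$, $\deg(f)\in\mathbb{W}^n$ is the $n$-tuple of partial degrees of $f$ in $x_1,\dots,x_n$, and $\mathrm{tdeg}(f)$ is its total degree; $f$ is of type $(\mathbf{m},k)$ if $\deg(f)=\mathbf{m}$ and $\mathrm{tdeg}(f)=k$. The order $\le$ on $\mathbb{W}^n$ is componentwise. The fixed divisor $d(\underline{S},f)$ is the ideal of $R$ generated by $\{f(\underline{s}):\underline{s}\in\underline{S}\}$. $\mathrm{Int}(\underline{S},R)=\{f\in K[\underline{x}]: f(\underline{S})\subseteq R\}$, and $\mathrm{Int}_{\mathbf{m},k}(\underline{S},R)=\{f\in\mathrm{Int}(\underline{S},R):\deg(f)\le\mathbf{m},\ \mathrm{tdeg}(f)\le k\}$ (including $0$). The generalized factorial of index $k$ with respect to $\mathbf{m}$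 is the ideal $\Gamma_{\mathbf{m},k}(\underline{S})=\{a\in R: a\,\mathrm{Int}_{\mathbf{m},k}(\underline{S},R)\subseteq R[\underline{x}]\}$. For ideals, $A$ divides $B$ means $B\subseteq A$.
   Formalization: Sharpness is false for some S (R=Z, S={0}×Z, m=(1,1), k=1). It is proved assuming: if a nonzero polynomial over K with deg ≤ m, tdeg ≤ k vanishes on S, then so does a primitive one of type (m,k); this is then necessary. Fields are not counted as Dedekind domains. *)

theory Defs
  imports
    "HOL-Library.Poly_Mapping"
    "HOL-Computational_Algebra.Polynomial_Factorial"
    "HOL-Algebra.Ring_Divisibility"
    "HOL-Algebra.Algebraic_Closure_Type"
begin

text \<open>The ambient ring \<open>R\<close> is a type \<open>'a::idom\<close> with field of fractions \<open>'a fract\<close>.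
  Ideals are those of HOL-Algebra, taken in the ring record \<open>ring_of_type_algebra\<close>.\<close>

abbreviation RR :: "'a::idom ring"
  where "RR \<equiv> ring_of_type_algebra"

definition integrally_closed :: "'a::idom itself \<Rightarrow> bool"
  where "integrally_closed _ \<longleftrightarrow>
    (\<forall>x :: 'a fract. (\<exists>p :: 'a poly. lead_coeff p = 1 \<and> poly (map_poly to_fract p) x = 0)
        \<longrightarrow> x \<in> range to_fract)"

text \<open>Convention: a field is not a Dedekind domain.\<close>

definition dedekind_domain :: "'a::idom itself \<Rightarrow> bool"
  where "dedekind_domain T \<longleftrightarrow>
    noetherian_domain (RR :: 'a ring) \<and>
    integrally_closed T \<and>
    (\<forall>P. primeideal P (RR :: 'a ring) \<and> P \<noteq> {0} \<longrightarrow> maximalideal P (RR :: 'a ring)) \<and>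
    \<not> Ring.field (RR :: 'a ring)"

definition ideal_divides :: "'a set \<Rightarrow> 'a set \<Rightarrow> bool"
  where "ideal_divides A B \<longleftrightarrow> B \<subseteq> A"

text \<open>Polynomials in variables indexed by the finite type \<open>'n\<close>: finitely supported
  coefficient functions on exponent vectors.\<close>

type_synonym ('n, 'c) mpoly = "('n \<Rightarrow>\<^sub>0 nat) \<Rightarrow>\<^sub>0 'c"

definition eval_mpoly :: "('n::finite, 'c::comm_ring_1) mpoly \<Rightarrow> ('n \<Rightarrow> 'c) \<Rightarrow> 'c"
  where "eval_mpoly f x =
    (\<Sum>e \<in> Poly_Mapping.keys f. Poly_Mapping.lookup f e * (\<Prod>i\<in>UNIV. x i ^ Poly_Mapping.lookup e i))"

text \<open>Both degrees of the zero polynomial are \<open>0\<close>, so that degree bounds never exclude it.\<close>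

definition partial_degrees :: "('n::finite, 'c::zero) mpoly \<Rightarrow> 'n \<Rightarrow> nat"
  where "partial_degrees f =
    (\<lambda>i. Max (insert 0 ((\<lambda>e. Poly_Mapping.lookup e i) ` Poly_Mapping.keys f)))"

definition total_degree :: "('n::finite, 'c::zero) mpoly \<Rightarrow> nat"
  where "total_degree f =
    Max (insert 0 ((\<lambda>e. \<Sum>i\<in>UNIV. Poly_Mapping.lookup e i) ` Poly_Mapping.keys f))"

definition of_type :: "('n::finite, 'c::zero) mpoly \<Rightarrow> ('n \<Rightarrow> nat) \<Rightarrow> nat \<Rightarrow> bool"
  where "of_type f m k \<longleftrightarrow> partial_degrees f = m \<and> total_degree f = k"

definition primitive_mpoly :: "('n, 'a::idom) mpoly \<Rightarrow> bool"
  where "primitive_mpoly f \<longleftrightarrow>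
    genideal RR (Poly_Mapping.lookup f ` Poly_Mapping.keys f) = UNIV"

definition fixed_divisor :: "('n::finite \<Rightarrow> 'a::idom) set \<Rightarrow> ('n, 'a) mpoly \<Rightarrow> 'a set"
  where "fixed_divisor S f = genideal RR {eval_mpoly f s | s. s \<in> S}"

text \<open>\<open>R[x]\<close> as a subset of \<open>K[x]\<close>.\<close>

definition integral_mpolys :: "('n, 'a::idom fract) mpoly set"
  where "integral_mpolys = {f. \<forall>e. Poly_Mapping.lookup f e \<in> range to_fract}"

definition Int_poly :: "('n::finite \<Rightarrow> 'a::idom) set \<Rightarrow> ('n, 'a fract) mpoly set"
  where "Int_poly S = {f. \<forall>s\<in>S. eval_mpoly f (\<lambda>i. to_fract (s i)) \<in> range to_fract}"

definition Int_poly_bounded ::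
    "('n::finite \<Rightarrow> 'a::idom) set \<Rightarrow> ('n \<Rightarrow> nat) \<Rightarrow> nat \<Rightarrow> ('n, 'a fract) mpoly set"
  where "Int_poly_bounded S m k =
    {f \<in> Int_poly S. partial_degrees f \<le> m \<and> total_degree f \<le> k}"

definition gen_factorial ::
    "('n::finite \<Rightarrow> 'a::idom) set \<Rightarrow> ('n \<Rightarrow> nat) \<Rightarrow> nat \<Rightarrow> 'a set"
  where "gen_factorial S m k =
    {a. \<forall>f \<in> Int_poly_bounded S m k. Poly_Mapping.single 0 (to_fract a) * f \<in> integral_mpolys}"

end

theory Submission
  imports Defs
begin

text \<open>Write \<open>\<Gamma>\<close> for the generalized factorial. If \<open>x\<close> lies in the inverse of the fixed divisor
  \<open>d\<close> of a primitive \<open>f\<close>, then \<open>x f\<close> is integer-valued, so every \<open>a \<in> \<Gamma>\<close> makes \<open>a x f\<close> integral and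
  hence \<open>a x \<in> R\<close>; since nonzero ideals of \<open>R\<close> are divisorial, \<open>a \<in> d\<close>.

  For sharpness, a nonzero polynomial vanishing on \<open>S\<close> forces \<open>\<Gamma> = 0\<close>. Otherwise
  \<open>\<Gamma> \<noteq> 0\<close>, and it suffices to find a primitive \<open>g\<close> of the right type with \<open>g(S) \<subseteq> \<Gamma>\<close>. Let \<open>G\<close> be the
  module of all \<open>g\<close> within the degree bounds with \<open>g(S) \<subseteq> \<Gamma>\<close>. If \<open>G \<subseteq> P R[x]\<close> for a prime
  \<open>P \<supseteq> \<Gamma>\<close>, then any \<open>x \<in> P\<^sup>-\<^sup>1\<close> would satisfy \<open>x \<Gamma> \<subseteq> \<Gamma>\<close> and so be integral, although \<open>P\<^sup>-\<^sup>1 \<noteq> R\<close>.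
  Avoiding the finitely many primes above \<open>\<Gamma>\<close> gives \<open>h \<in> G\<close> that is nonzero modulo each of them, and
  this persists under adding polynomials with coefficients in \<open>\<Gamma>\<close>. Such a change makes all coefficients nonzero
  and moves one nonconstant coefficient out of the finitely many other primes that contain the constant one.\<close>

section \<open>Ideals\<close>

text \<open>Ideals and primes are restated with type class arithmetic, so that element computations
  avoid the ring record. \<open>ideal_RR_iff\<close> and \<open>primeideal_RR\<close> lead back to
  HOL-Algebra.\<close>

definition is_ideal :: "'a::comm_ring_1 set \<Rightarrow> bool"
  where "is_ideal I \<longleftrightarrow> 0 \<in> I \<and> (\<forall>x\<in>I. \<forall>y\<in>I. x + y \<in> I) \<and> (\<forall>r. \<forall>x\<in>I. r * x \<in> I)"

definition is_prime :: "'a::comm_ring_1 set \<Rightarrow> bool"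
  where "is_prime P \<longleftrightarrow> is_ideal P \<and> 1 \<notin> P \<and> (\<forall>a b. a * b \<in> P \<longrightarrow> a \<in> P \<or> b \<in> P)"

lemma is_idealI:
  assumes "0 \<in> I" "\<And>x y. x \<in> I \<Longrightarrow> y \<in> I \<Longrightarrow> x + y \<in> I" "\<And>r x. x \<in> I \<Longrightarrow> r * x \<in> I"
  shows "is_ideal I"
  using assms by (auto simp: is_ideal_def)

lemma is_idealD:
  assumes "is_ideal I"
  shows "0 \<in> I" "x \<in> I \<Longrightarrow> y \<in> I \<Longrightarrow> x + y \<in> I" "x \<in> I \<Longrightarrow> r * x \<in> I" "x \<in> I \<Longrightarrow> x * r \<in> I"
    "x \<in> I \<Longrightarrow> y \<in> I \<Longrightarrow> x - y \<in> I"
proof -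
  show 1: "0 \<in> I" "x \<in> I \<Longrightarrow> y \<in> I \<Longrightarrow> x + y \<in> I" "x \<in> I \<Longrightarrow> r * x \<in> I" for x y r
    using assms by (auto simp: is_ideal_def)
  show "x \<in> I \<Longrightarrow> x * r \<in> I"
    using 1(3)[of x r] by (simp add: mult.commute)
  show "x \<in> I \<Longrightarrow> y \<in> I \<Longrightarrow> x - y \<in> I"
    using 1(2)[of x "- y"] 1(3)[of y "- 1"] by simp
qed

lemma is_primeD:
  assumes "is_prime P"
  shows "is_ideal P" "1 \<notin> P" "a * b \<in> P \<Longrightarrow> a \<in> P \<or> b \<in> P"
  using assms by (auto simp: is_prime_def)

lemma ideal_nonzero_iff: "is_ideal I \<Longrightarrow> I \<noteq> {0} \<longleftrightarrow> (\<exists>c\<in>I. c \<noteq> 0)"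
  using is_idealD(1) by fastforce

lemma is_ideal_principal: "is_ideal (range ((*) (a::'a::comm_ring_1)))"
proof (rule is_idealI)
  show "0 \<in> range ((*) a)" by (rule range_eqI[of _ _ 0]) simp
  show "x + y \<in> range ((*) a)" if "x \<in> range ((*) a)" "y \<in> range ((*) a)" for x y
    using that by (auto simp flip: distrib_left)
  show "r * x \<in> range ((*) a)" if "x \<in> range ((*) a)" for r x
    using that by (auto simp: mult.left_commute)
qed

text \<open>This is the ideal \<open>I + (a)\<close>, by which maximal ideals of a family are
  enlarged below.\<close>

lemma is_ideal_add_principal:
  assumes "is_ideal I"
  shows "is_ideal {i + r * a |i r. i \<in> I}"
proof (rule is_idealI)
  show "0 \<in> {i + r * a |i r. i \<in> I}"
    using is_idealD(1)[OF assms] by (intro CollectI exI[of _ 0]) simp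
  fix x y r
  assume "x \<in> {i + r * a |i r. i \<in> I}"
  then obtain i u where x: "x = i + u * a" "i \<in> I" by auto
  show "r * x \<in> {i + r * a |i r. i \<in> I}"
    using is_idealD(3)[OF assms x(2)] x(1)
    by (intro CollectI exI[of _ "r * i"] exI[of _ "r * u"]) (simp add: distrib_left mult.assoc)
  assume "y \<in> {i + r * a |i r. i \<in> I}"
  then obtain j v where y: "y = j + v * a" "j \<in> I" by auto
  show "x + y \<in> {i + r * a |i r. i \<in> I}"
    using is_idealD(2)[OF assms x(2) y(2)] x(1) y(1)
    by (intro CollectI exI[of _ "i + j"] exI[of _ "u + v"]) (simp add: algebra_simps)
qed

lemma subset_add_principal: "I \<subseteq> {i + r * a |i r. i \<in> I}" for a :: "'a::comm_ring_1"
proof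
  fix x assume "x \<in> I"
  then show "x \<in> {i + r * a |i r. i \<in> I}"
    by (intro CollectI exI[of _ x] exI[of _ 0]) simp
qed

lemma RR_sel [simp]:
  "carrier RR = UNIV" "\<zero>\<^bsub>RR\<^esub> = 0" "\<one>\<^bsub>RR\<^esub> = 1" "x \<oplus>\<^bsub>RR\<^esub> y = x + y" "x \<otimes>\<^bsub>RR\<^esub> y = x * y"
  by (simp_all add: ring_of_type_algebra_def)

lemma ideal_RR_iff: "ideal I (RR :: 'a::idom ring) \<longleftrightarrow> is_ideal I"
proof
  assume "ideal I (RR :: 'a ring)"
  then interpret ideal I "RR :: 'a ring" .
  show "is_ideal I"
    using additive_subgroup.zero_closed[OF additive_subgroup_axioms]
      additive_subgroup.a_closed[OF additive_subgroup_axioms] I_l_closed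
    by (intro is_idealI) simp_all
next
  assume I: "is_ideal I"
  interpret R: cring "RR :: 'a ring" by (rule cring_from_type_algebra)
  have neg: "\<ominus>\<^bsub>RR\<^esub> x = - x" for x :: 'a
    by (rule R.minus_equality) auto
  have "subgroup I (add_monoid (RR :: 'a ring))"
  proof
    show "inv\<^bsub>add_monoid RR\<^esub> x \<in> I" if "x \<in> I" for x
      using is_idealD(5)[OF I is_idealD(1)[OF I] that] neg[of x] by (simp add: a_inv_def)
  qed (use is_idealD[OF I] in auto)
  then show "ideal I (RR :: 'a ring)"
    using is_idealD[OF I] R.ring_axioms by (intro idealI) auto
qed

lemma primeideal_RR:
  assumes "is_prime P" shows "primeideal P (RR :: 'a::idom ring)"
proof (rule primeidealI)
  show "ideal P (RR :: 'a ring)"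
    using assms by (simp add: ideal_RR_iff is_primeD)
  show "cring (RR :: 'a ring)" by (rule cring_from_type_algebra)
qed (use is_primeD[OF assms] in auto)

lemma genideal_RR: "genideal RR (W :: 'a::idom set) = \<Inter>{I. is_ideal I \<and> W \<subseteq> I}"
  by (simp add: genideal_def ideal_RR_iff)

lemma is_ideal_genideal: "is_ideal (genideal RR (W :: 'a::idom set))"
  unfolding genideal_RR by (intro is_idealI) (auto dest: is_idealD)

lemma genideal_least: "is_ideal I \<Longrightarrow> W \<subseteq> I \<Longrightarrow> genideal RR (W :: 'a::idom set) \<subseteq> I"
  by (auto simp: genideal_RR)

lemma genideal_superset: "W \<subseteq> genideal RR (W :: 'a::idom set)"
  by (auto simp: genideal_RR)

lemma ideal_UNIV_iff: "is_ideal I \<Longrightarrow> I = UNIV \<longleftrightarrow> 1 \<in> I"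
  using is_idealD(3)[of I 1] by auto

section \<open>The image of the ring in its fraction field\<close>

lemma integral_add: "x \<in> range to_fract \<Longrightarrow> y \<in> range to_fract \<Longrightarrow> x + y \<in> range to_fract"
  by (metis (no_types, lifting) image_iff rangeI to_fract_add)

lemma integral_diff: "x \<in> range to_fract \<Longrightarrow> y \<in> range to_fract \<Longrightarrow> x - y \<in> range to_fract"
  by (metis (no_types, lifting) image_iff rangeI to_fract_diff)

lemma integral_mult: "x \<in> range to_fract \<Longrightarrow> y \<in> range to_fract \<Longrightarrow> x * y \<in> range to_fract"
  by (metis (no_types, lifting) image_iff rangeI to_fract_mult)

lemma integral_0 [simp]: "0 \<in> range to_fract"
  by (metis rangeI to_fract_0)

lemma integral_sum: "(\<And>i. i \<in> A \<Longrightarrow> f i \<in> range to_fract) \<Longrightarrow> sum f A \<in> range to_fract"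
  by (induction A rule: infinite_finite_induct) (auto intro: integral_add)

section \<open>Dedekind domains\<close>

locale dedekind =
  fixes T :: "'a::idom itself"
  assumes dedekind: "dedekind_domain TYPE('a)"
begin

text \<open>Zorn's lemma applies because in a noetherian ring the union of a nonempty chain of
  ideals belongs to the chain. The lemma supplies maximal counterexamples.\<close>

lemma noetherian:
  fixes I :: "'a set"
  assumes "good I" "\<And>I. good I \<Longrightarrow> is_ideal I"
  obtains M where "good M" "\<And>W. good W \<Longrightarrow> M \<subseteq> W \<Longrightarrow> W = M"
proof -
  interpret noetherian_domain "RR :: 'a ring"
    using dedekind by (simp add: dedekind_domain_def)
  have "\<exists>M\<in>Collect good. \<forall>W\<in>Collect good. M \<subseteq> W \<longrightarrow> W = M"
  proof (rule subset_Zorn_nonempty)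
    fix \<C> assume \<C>: "\<C> \<noteq> {}" "subset.chain (Collect good) \<C>"
    then have "subset.chain {I. ideal I (RR :: 'a ring)} \<C>"
      using assms(2) by (auto simp: subset_chain_def ideal_RR_iff)
    then have "\<Union>\<C> \<in> \<C>"
      using \<C>(1) by (rule ideal_chain_is_trivial[rotated])
    then show "\<Union>\<C> \<in> Collect good" using \<C>(2) by (auto simp: subset_chain_def)
  qed (use assms(1) in auto)
  then show ?thesis using that by blast
qed

lemma prime_maximal:
  fixes P :: "'a set"
  assumes "is_prime P" "P \<noteq> {0}" "is_ideal J" "P \<subseteq> J" "1 \<notin> J"
  shows "J = P"
proof -
  interpret maximalideal P "RR :: 'a ring"
    using dedekind assms(1,2) by (simp add: dedekind_domain_def primeideal_RR)
  show ?thesis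
    using I_maximal[of J] assms by (auto simp: ideal_RR_iff)
qed

text \<open>If every nonzero element were a unit, the ring would be a field, which the convention on
  Dedekind domains excludes.\<close>

lemma ex_nonunit: "\<exists>t::'a. t \<noteq> 0 \<and> \<not> t dvd 1"
proof (rule ccontr)
  assume *: "\<not> ?thesis"
  interpret R: domain "RR :: 'a ring"
    using dedekind by (simp add: dedekind_domain_def noetherian_domain_def)
  have "Units (RR :: 'a ring) = carrier RR - {\<zero>\<^bsub>RR\<^esub>}"
  proof -
    have "x \<in> Units (RR :: 'a ring)" if "x \<noteq> 0" for x
    proof -
      from * that obtain y where "1 = x * y" by blast
      then show ?thesis by (auto simp: Units_def mult.commute intro!: exI[of _ y])
    qed
    then show ?thesis by (auto simp: Units_def)
  qed
  then have "Ring.field (RR :: 'a ring)" by unfold_locales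
  then show False using dedekind by (simp add: dedekind_domain_def)
qed

text \<open>For \<open>0 \<noteq> c \<in> I\<close> the ideals \<open>J n = R \<inter> c (R + R x + \<dots> + R x\<^sup>n)\<close> stabilize, and all \<open>c x\<^sup>n\<close> lie
  in \<open>R\<close>, which yields a monic equation for \<open>x\<close>.\<close>

lemma stabilizer_integral:
  fixes I :: "'a set"
  assumes I: "is_ideal I" "I \<noteq> {0}"
    and x: "\<And>i. i \<in> I \<Longrightarrow> x * to_fract i \<in> to_fract ` I"
  shows "x \<in> range to_fract"
proof -
  obtain c where c: "c \<in> I" "c \<noteq> 0" using I ideal_nonzero_iff by blast
  have pow: "x ^ n * to_fract c \<in> to_fract ` I" for n
  proof (induction n)
    case (Suc n)
    then obtain i where "i \<in> I" "x ^ n * to_fract c = to_fract i" by auto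
    then show ?case using x[of i] by (simp add: mult.assoc)
  qed (use c in simp)
  define J where "J n = {r. \<exists>q::'a poly. degree q \<le> n \<and> to_fract r = poly (fract_poly q) x * to_fract c}"
    for n :: nat
  have "is_ideal L" if ex: "\<exists>n. L = J n" for L
  proof -
    obtain n where L: "L = J n" using ex by blast
    show "is_ideal L"
    proof (rule is_idealI)
      show "0 \<in> L" unfolding L J_def by (intro CollectI exI[of _ 0]) simp
      fix a b r assume a: "a \<in> L"
      then obtain p where p: "degree p \<le> n" "to_fract a = poly (fract_poly p) x * to_fract c"
        unfolding L J_def by auto
      show "r * a \<in> L" unfolding L J_def
        using p by (intro CollectI exI[of _ "smult r p"]) (auto intro: order_trans[OF degree_smult_le])
      assume "b \<in> L"
      then obtain q where q: "degree q \<le> n" "to_fract b = poly (fract_poly q) x * to_fract c"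
        unfolding L J_def by auto
      show "a + b \<in> L" unfolding L J_def
        using p q by (intro CollectI exI[of _ "p + q"]) (auto simp: algebra_simps degree_add_le)
    qed
  qed
  then obtain n where "J n \<subseteq> J (Suc n) \<longrightarrow> J (Suc n) = J n"
    using noetherian[of "\<lambda>L. \<exists>n. L = J n" "J 0"] by metis
  moreover have "J n \<subseteq> J (Suc n)" unfolding J_def using le_SucI by blast
  ultimately have J: "J (Suc n) = J n" by blast
  obtain r where r: "x ^ Suc n * to_fract c = to_fract r" using pow[of "Suc n"] by auto
  \<comment> \<open>Since \<open>J (Suc n) = J n\<close>, the power \<open>x ^ Suc n\<close> becomes
    a polynomial of degree at most \<open>n\<close> in \<open>x\<close>.\<close>
  have "r \<in> J (Suc n)" unfolding J_def
    using r by (intro CollectI exI[of _ "monom 1 (Suc n)"])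
      (auto simp: degree_monom_eq map_poly_monom poly_monom)
  then obtain q :: "'a poly" where q: "degree q \<le> n" "to_fract r = poly (fract_poly q) x * to_fract c"
    unfolding J unfolding J_def by auto
  have root: "poly (fract_poly q) x = x ^ Suc n" using q(2) r c(2) by simp
  define p where "p = monom 1 (Suc n) - q"
  have "degree p \<le> Suc n" unfolding p_def
    by (rule degree_diff_le) (use q in \<open>auto simp: degree_monom_eq\<close>)
  moreover have "coeff p (Suc n) = 1" using q by (simp add: p_def coeff_eq_0)
  ultimately have "lead_coeff p = 1"
    using le_degree[of p "Suc n"] by (simp add: le_antisym)
  moreover have "poly (fract_poly p) x = 0"
    using root by (simp add: p_def map_poly_monom poly_monom)
  ultimately have "\<exists>p :: 'a poly. lead_coeff p = 1 \<and> poly (fract_poly p) x = 0" by blast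
  moreover have "integrally_closed TYPE('a)" using dedekind by (simp add: dedekind_domain_def)
  ultimately show ?thesis unfolding integrally_closed_def by blast
qed

text \<open>An ideal that is maximal among the proper ideals above \<open>I\<close> is
  prime.\<close>

lemma prime_superset:
  fixes I :: "'a set"
  assumes "is_ideal I" "1 \<notin> I"
  obtains P where "is_prime P" "I \<subseteq> P"
proof -
  let ?Q = "\<lambda>J. is_ideal J \<and> I \<subseteq> J \<and> 1 \<notin> J"
  obtain M where M0: "?Q M" and max0: "\<And>W. ?Q W \<Longrightarrow> M \<subseteq> W \<Longrightarrow> W = M"
    using noetherian[of ?Q I] assms by blast
  note M = M0[THEN conjunct1] M0[THEN conjunct2, THEN conjunct1] M0[THEN conjunct2, THEN conjunct2]
  have max: "W = M" if "is_ideal W" "M \<subseteq> W" "1 \<notin> W" for W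
    using max0[of W] that M by (meson subset_trans)
  have "a \<in> M \<or> b \<in> M" if ab: "a * b \<in> M" for a b
  proof (rule ccontr)
    assume not: "\<not> (a \<in> M \<or> b \<in> M)"
    \<comment> \<open>\<open>M + (a)\<close> properly contains \<open>M\<close>, hence contains 1.
      Multiplying \<open>1 = i + r * a\<close> by \<open>b\<close> puts \<open>b\<close> into
      \<open>M\<close>.\<close>
    let ?J = "{i + r * a |i r. i \<in> M}"
    have "M \<subseteq> ?J" by (rule subset_add_principal)
    moreover have "a \<in> ?J" using is_idealD(1)[OF M(1)]
      by (intro CollectI exI[of _ 0] exI[of _ 1]) simp
    ultimately have "1 \<in> ?J"
      using max[OF is_ideal_add_principal[OF M(1)], of a] not by blast
    then obtain i r where "1 = i + r * a" "i \<in> M" by blast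
    then have "b = b * i + r * (a * b)" by (metis mult.commute mult.left_commute mult_1 distrib_left)
    then show False using not ab \<open>i \<in> M\<close> is_idealD[OF M(1)] by metis
  qed
  then show ?thesis using M that by (auto simp: is_prime_def)
qed

text \<open>Every nonzero ideal contains a product of nonzero primes. The product is encoded by
  choosing one element from each prime in a list, which avoids products of ideals. A maximal
  counterexample \<open>M\<close> is proper and not prime, so \<open>a * b\<close> lies in
  \<open>M\<close> for some \<open>a\<close>, \<open>b\<close> outside, and the lists for
  \<open>M + (a)\<close> and \<open>M + (b)\<close> can be concatenated.\<close>

lemma ex_prime_product:
  fixes I :: "'a set"
  assumes I: "is_ideal I" "I \<noteq> {0}"
  shows "\<exists>Ps. (\<forall>P\<in>set Ps. is_prime P \<and> P \<noteq> {0}) \<and> (\<forall>xs. list_all2 (\<in>) xs Ps \<longrightarrow> prod_list xs \<in> I)"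
    (is "?good I")
proof (rule ccontr)
  assume "\<not> ?good I"
  let ?Q = "\<lambda>J. is_ideal J \<and> J \<noteq> {0} \<and> \<not> ?good J"
  have "?Q I" using I \<open>\<not> ?good I\<close> by blast
  then obtain M where M0: "?Q M" and max0: "\<And>W. ?Q W \<Longrightarrow> M \<subseteq> W \<Longrightarrow> W = M"
    by (rule noetherian[of ?Q]) blast+
  note M = M0[THEN conjunct1] M0[THEN conjunct2, THEN conjunct1] M0[THEN conjunct2, THEN conjunct2]
  have max: "W = M" if "is_ideal W" "W \<noteq> {0}" "M \<subseteq> W" "\<not> ?good W" for W
    using that by (intro max0 conjI)
  have "1 \<notin> M"
  proof
    assume "1 \<in> M"
    \<comment> \<open>The empty product is 1, so the empty list serves the unit ideal.\<close>
    then have "?good M" by (intro exI[of _ "[]"]) auto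
    then show False using M(3) by blast
  qed
  moreover have "\<not> is_prime M"
  proof
    assume "is_prime M"
    then have "?good M" using M(2) by (intro exI[of _ "[M]"]) (auto simp: list_all2_Cons2)
    then show False using M(3) by blast
  qed
  ultimately obtain a b where ab: "a \<notin> M" "b \<notin> M" "a * b \<in> M"
    using M(1) by (auto simp: is_prime_def)
  have good: "?good {i + r * a |i r. i \<in> M}" if "a \<notin> M" for a
  proof (rule ccontr)
    assume "\<not> ?good {i + r * a |i r. i \<in> M}"
    moreover have sub: "M \<subseteq> {i + r * a |i r. i \<in> M}" by (rule subset_add_principal)
    moreover have "{i + r * a |i r. i \<in> M} \<noteq> {0}"
      using sub M(1,2) is_idealD(1) by fast
    ultimately have "{i + r * a |i r. i \<in> M} = M"
      by (intro max is_ideal_add_principal M(1))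
    moreover have "a \<in> {i + r * a |i r. i \<in> M}" using is_idealD(1)[OF M(1)]
      by (intro CollectI exI[of _ 0] exI[of _ 1]) simp
    ultimately show False using that by blast
  qed
  obtain Ps where Ps: "\<forall>P\<in>set Ps. is_prime P \<and> P \<noteq> {0}"
      "\<forall>xs. list_all2 (\<in>) xs Ps \<longrightarrow> prod_list xs \<in> {i + r * a |i r. i \<in> M}"
    using good[OF ab(1)] by blast
  obtain Qs where Qs: "\<forall>P\<in>set Qs. is_prime P \<and> P \<noteq> {0}"
      "\<forall>xs. list_all2 (\<in>) xs Qs \<longrightarrow> prod_list xs \<in> {i + r * b |i r. i \<in> M}"
    using good[OF ab(2)] by blast
  have "prod_list xs \<in> M" if xs_in: "list_all2 (\<in>) xs (Ps @ Qs)" for xs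
  proof -
    obtain ys zs where xs: "xs = ys @ zs" "list_all2 (\<in>) ys Ps" "list_all2 (\<in>) zs Qs"
      using xs_in by (auto simp: list_all2_append2)
    obtain i r where i: "prod_list ys = i + r * a" "i \<in> M" using Ps(2) xs(2) by blast
    obtain j s where j: "prod_list zs = j + s * b" "j \<in> M" using Qs(2) xs(3) by blast
    have "prod_list xs = i * (j + s * b) + (r * a) * j + (r * s) * (a * b)"
      by (simp add: xs(1) i(1) j(1) algebra_simps)
    also have "\<dots> \<in> M" by (intro is_idealD[OF M(1)] i j ab)
    finally show ?thesis .
  qed
  then have "?good M" using Ps(1) Qs(1) by (intro exI[of _ "Ps @ Qs"]) auto
  then show False using M(3) by blast
qed

text \<open>Otherwise each factor has an element outside \<open>P\<close>, and by primality their
  product is outside \<open>P\<close> as well.\<close>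

lemma prime_contains_factor:
  fixes P :: "'a set"
  assumes "is_prime P" and "\<And>xs. list_all2 (\<in>) xs Ps \<Longrightarrow> prod_list xs \<in> P"
  shows "\<exists>Q\<in>set Ps. Q \<subseteq> P"
  using assms(2)
proof (induction Ps)
  case Nil
  then show ?case using is_primeD(2)[OF assms(1)] by auto
next
  case (Cons Q Ps)
  show ?case
  proof (cases "Q \<subseteq> P")
    case False
    then obtain q where q: "q \<in> Q" "q \<notin> P" by auto
    have "\<exists>Q\<in>set Ps. Q \<subseteq> P"
    proof (rule Cons.IH)
      fix xs assume "list_all2 (\<in>) xs Ps"
      then have "prod_list (q # xs) \<in> P" using q by (intro Cons.prems) auto
      then show "prod_list xs \<in> P" using q is_primeD(3)[OF assms(1)] by auto
    qed
    then show ?thesis by auto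
  qed auto
qed

text \<open>A prime containing \<open>c\<close> contains one of the finitely many primes whose
  product lies in \<open>(c)\<close>, and equals it by maximality.\<close>

lemma finite_primes_containing:
  assumes "(c::'a) \<noteq> 0"
  shows "finite {P. is_prime P \<and> c \<in> P}"
proof -
  have "c \<in> range ((*) c)" by (rule range_eqI[of _ _ 1]) simp
  then have "range ((*) c) \<noteq> {0}" using assms by blast
  then obtain Ps where Ps: "\<forall>P\<in>set Ps. is_prime P \<and> P \<noteq> {0}"
      "\<forall>xs. list_all2 (\<in>) xs Ps \<longrightarrow> prod_list xs \<in> range ((*) c)"
    using ex_prime_product[OF is_ideal_principal] by blast
  have "P \<in> set Ps" if P: "is_prime P" "c \<in> P" for P
  proof -
    have "range ((*) c) \<subseteq> P" using P is_idealD(4) is_primeD(1) by blast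
    then have "\<exists>Q\<in>set Ps. Q \<subseteq> P"
      using Ps(2) by (intro prime_contains_factor[OF P(1)]) blast
    then obtain Q where Q: "Q \<in> set Ps" "Q \<subseteq> P" by blast
    have "P = Q"
      using Ps(1) Q P by (intro prime_maximal) (auto dest: is_primeD)
    then show ?thesis using Q by simp
  qed
  then have "{P. is_prime P \<and> c \<in> P} \<subseteq> set Ps" by auto
  then show ?thesis by (rule finite_subset) simp
qed

text \<open>Take \<open>0 \<noteq> a \<in> P\<close> and a shortest list of primes with product
  inside \<open>(a)\<close>. One of them is \<open>P\<close>. Omitting it yields \<open>b\<close>
  outside \<open>(a)\<close> with \<open>b P\<close> inside \<open>(a)\<close>, and
  \<open>x = b / a\<close>.\<close>

lemma prime_inverse:
  fixes P :: "'a set"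
  assumes P: "is_prime P" "P \<noteq> {0}"
  obtains x where "x \<notin> range to_fract" "\<And>p. p \<in> P \<Longrightarrow> x * to_fract p \<in> range to_fract"
proof -
  note idP = is_primeD(1)[OF P(1)]
  obtain a where a: "a \<in> P" "a \<noteq> 0" using P(2) idP ideal_nonzero_iff by blast
  let ?ok = "\<lambda>Ps. (\<forall>P\<in>set Ps. is_prime P \<and> P \<noteq> {0}) \<and>
      (\<forall>xs. list_all2 (\<in>) xs Ps \<longrightarrow> prod_list xs \<in> range ((*) a))"
  have "a \<in> range ((*) a)" by (rule range_eqI[of _ _ 1]) simp
  then have "range ((*) a) \<noteq> {0}" using a by blast
  then have "\<exists>Ps. ?ok Ps" by (rule ex_prime_product[OF is_ideal_principal])
  then obtain Ps0 where "?ok Ps0" ..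
  from ex_has_least_nat[of ?ok, OF this, of length]
  obtain Ps where ok: "?ok Ps" and min: "\<And>Qs. ?ok Qs \<Longrightarrow> length Ps \<le> length Qs" by auto
  have sub: "range ((*) a) \<subseteq> P" using is_idealD(4)[OF idP a(1)] by blast
  obtain Q where Q: "Q \<in> set Ps" "Q \<subseteq> P"
    using prime_contains_factor[OF P(1), of Ps] ok sub by blast
  have PQ: "P = Q"
    using ok Q P by (intro prime_maximal) (auto dest: is_primeD)
  then obtain As Bs where Ps: "Ps = As @ P # Bs" using Q(1) by (auto dest: split_list)
  \<comment> \<open>By minimality of the length, some product over the shortened list escapes
    \<open>(a)\<close>; it becomes \<open>b\<close>.\<close>
  have "\<not> ?ok (As @ Bs)" using min[of "As @ Bs"] Ps by auto
  then obtain zs where "list_all2 (\<in>) zs (As @ Bs)" and b: "prod_list zs \<notin> range ((*) a)"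
    using ok Ps by auto
  then obtain xs ys where xy: "zs = xs @ ys" "list_all2 (\<in>) xs As" "list_all2 (\<in>) ys Bs"
    by (auto simp: list_all2_append2)
  define b where "b = prod_list zs"
  define x where "x = to_fract b / to_fract a"
  have "x * to_fract p \<in> range to_fract" if "p \<in> P" for p
  proof -
    have "list_all2 (\<in>) (xs @ p # ys) Ps"
      unfolding Ps using xy that by (intro list_all2_appendI) auto
    then have "prod_list (xs @ p # ys) \<in> range ((*) a)" using ok by blast
    then obtain r where "b * p = a * r" by (auto simp: b_def xy(1) mult_ac)
    then have "to_fract b * to_fract p = to_fract a * to_fract r" by (metis to_fract_mult)
    then have "x * to_fract p = to_fract r" using a by (simp add: x_def field_simps)
    then show ?thesis by simp
  qed
  moreover have "x \<notin> range to_fract"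
  proof
    assume "x \<in> range to_fract"
    then obtain r where "x = to_fract r" by auto
    then have "to_fract b = to_fract (a * r)" using a by (simp add: x_def field_simps)
    then show False using b b_def by (metis rangeI to_fract_eq_iff)
  qed
  ultimately show ?thesis using that by blast
qed

text \<open>Noetherian induction from \<open>I + x I\<close> to \<open>I\<close>, where \<open>x\<close> is a non-integral element of the inverse of a
  prime \<open>P \<supseteq> I\<close>. No ideal product is needed because \<open>P + x P = R\<close> supplies \<open>p, q \<in> P\<close>
  with \<open>q + x p = 1\<close>.\<close>

lemma divisorial:
  fixes I :: "'a set"
  assumes "is_ideal I" "I \<noteq> {0}"
    and "\<And>x. (\<And>i. i \<in> I \<Longrightarrow> x * to_fract i \<in> range to_fract) \<Longrightarrow> x * to_fract a \<in> range to_fract"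
  shows "a \<in> I"
proof -
  define good where "good I \<longleftrightarrow> (\<forall>a. (\<forall>x. (\<forall>i\<in>I. x * to_fract i \<in> range to_fract) \<longrightarrow>
      x * to_fract a \<in> range to_fract) \<longrightarrow> a \<in> I)" for I :: "'a set"
  have "good I"
  proof (rule ccontr)
    assume "\<not> good I"
    let ?Q = "\<lambda>J. is_ideal J \<and> J \<noteq> {0} \<and> \<not> good J"
    have "?Q I" using assms(1,2) \<open>\<not> good I\<close> by blast
    then obtain M where M0: "?Q M" and max0: "\<And>W. ?Q W \<Longrightarrow> M \<subseteq> W \<Longrightarrow> W = M"
      by (rule noetherian[of ?Q]) blast+
    note M = M0[THEN conjunct1] M0[THEN conjunct2, THEN conjunct1] M0[THEN conjunct2, THEN conjunct2]
    have max: "W = M" if "is_ideal W" "W \<noteq> {0}" "M \<subseteq> W" "\<not> good W" for W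
      using that by (intro max0 conjI)
    have "1 \<notin> M"
    proof
      assume "1 \<in> M"
      then have "M = UNIV" using ideal_UNIV_iff M(1) by blast
      then show False using M(3) by (auto simp: good_def)
    qed
    then obtain P where P: "is_prime P" "M \<subseteq> P" using prime_superset[OF M(1)] by blast
    note idP = is_primeD(1)[OF P(1)]
    have Pnz: "P \<noteq> {0}" using M P is_idealD(1) by fast
    obtain x where x: "x \<notin> range to_fract" "\<And>p. p \<in> P \<Longrightarrow> x * to_fract p \<in> range to_fract"
      using prime_inverse[OF P(1) Pnz] by blast
    \<comment> \<open>\<open>?E I\<close> is the intersection of \<open>R\<close> with
      \<open>I + x I\<close>.\<close>
    let ?E = "\<lambda>I. {r. \<exists>i\<in>I. \<exists>j\<in>I. to_fract r = to_fract i + x * to_fract j}"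
    have idE: "is_ideal (?E I)" if I: "is_ideal I" for I
    proof (rule is_idealI)
      show "0 \<in> ?E I" using is_idealD(1)[OF I] by (auto intro!: bexI[of _ 0])
      fix u v r assume "u \<in> ?E I"
      then obtain i j where u: "i \<in> I" "j \<in> I" "to_fract u = to_fract i + x * to_fract j" by blast
      show "r * u \<in> ?E I"
        using u by (intro CollectI bexI[of _ "r * i"] bexI[of _ "r * j"] is_idealD(3)[OF I])
          (simp_all add: algebra_simps)
      assume "v \<in> ?E I"
      then obtain k l where v: "k \<in> I" "l \<in> I" "to_fract v = to_fract k + x * to_fract l" by blast
      show "u + v \<in> ?E I"
        using u v by (intro CollectI bexI[of _ "i + k"] bexI[of _ "j + l"] is_idealD(2)[OF I])
          (simp_all add: algebra_simps)
    qed
    have subE: "I \<subseteq> ?E I" if I: "is_ideal I" for I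
    proof
      fix i assume "i \<in> I"
      then show "i \<in> ?E I"
        using is_idealD(1)[OF I] by (intro CollectI bexI[of _ i] bexI[of _ 0]) simp_all
    qed
    \<comment> \<open>For \<open>I \<subseteq> P\<close> the equality \<open>?E I = I\<close> means
      \<open>x I \<subseteq> I\<close>, so \<open>x\<close> would be integral over \<open>R\<close>.
      Hence \<open>?E\<close> properly enlarges both \<open>P\<close> and \<open>M\<close>.\<close>
    have eq_imp: "x \<in> range to_fract" if I: "is_ideal I" "I \<noteq> {0}" "I \<subseteq> P" and eq: "?E I = I" for I
    proof (rule stabilizer_integral[OF I(1,2)])
      fix i assume i: "i \<in> I"
      then obtain r where r: "x * to_fract i = to_fract r" using x(2) I(3) by blast
      then have "r \<in> ?E I" using i is_idealD(1)[OF I(1)]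
        by (intro CollectI bexI[of _ 0] bexI[of _ i]) simp_all
      then show "x * to_fract i \<in> to_fract ` I" using r eq by auto
    qed
    have "1 \<in> ?E P"
      using prime_maximal[OF P(1) Pnz idE[OF idP] subE[OF idP]] eq_imp[OF idP Pnz] x(1) by blast
    then obtain q p where pq: "p \<in> P" "q \<in> P" "to_fract 1 = to_fract q + x * to_fract p" by blast
    have "good (?E M)"
    proof (rule ccontr)
      assume "\<not> good (?E M)"
      moreover have "?E M \<noteq> {0}" using subE[OF M(1)] M(1,2) is_idealD(1) by fast
      ultimately have "?E M = M" by (intro max idE subE M(1))
      then show False using eq_imp[OF M(1,2) P(2)] x(1) by blast
    qed
    moreover have "good M" unfolding good_def
    proof (intro allI impI)
      fix a assume a: "\<forall>y. (\<forall>i\<in>M. y * to_fract i \<in> range to_fract) \<longrightarrow> y * to_fract a \<in> range to_fract"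
      have "x * to_fract a \<in> range to_fract" using a x(2) P(2) by blast
      then obtain a' where a': "x * to_fract a = to_fract a'" by auto
      \<comment> \<open>If \<open>y\<close> carries \<open>?E M\<close> into \<open>R\<close>, then
        both \<open>y\<close> and \<open>y * x\<close> carry \<open>M\<close> into \<open>R\<close>.
        The assumption on \<open>a\<close> then applies to both multipliers, which handles
        \<open>a\<close> and \<open>a' = x a\<close>.\<close>
      have both: "b \<in> ?E M" if b: "b = a \<or> b = a'" for b
      proof -
        have "y * to_fract b \<in> range to_fract"
          if y: "\<forall>i\<in>?E M. y * to_fract i \<in> range to_fract" for y
        proof -
          have "\<forall>i\<in>M. y * to_fract i \<in> range to_fract" using y subE[OF M(1)] by blast
          then have 1: "y * to_fract a \<in> range to_fract" using a by blast
          have "(y * x) * to_fract i \<in> range to_fract" if i: "i \<in> M" for i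
          proof -
            obtain r where r: "x * to_fract i = to_fract r" using x(2) i P(2) by blast
            then have "r \<in> ?E M" using i is_idealD(1)[OF M(1)]
              by (intro CollectI bexI[of _ 0] bexI[of _ i]) simp_all
            then show ?thesis using y r by (auto simp: mult.assoc)
          qed
          then have "(y * x) * to_fract a \<in> range to_fract" using a by blast
          then have "y * to_fract a' \<in> range to_fract" by (simp add: a'[symmetric] mult.assoc)
          then show ?thesis using 1 b by blast
        qed
        then show ?thesis using \<open>good (?E M)\<close> unfolding good_def by blast
      qed
      \<comment> \<open>Multiplication by \<open>P\<close> brings \<open>M + x M\<close> back into
        \<open>M\<close>, because \<open>x P \<subseteq> R\<close>.\<close>
      have mem: "b * p \<in> M" if bp: "b \<in> ?E M" "p \<in> P" for b p
      proof -
        obtain i j where ij: "i \<in> M" "j \<in> M" "to_fract b = to_fract i + x * to_fract j"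
          using bp(1) by blast
        obtain r where r: "x * to_fract p = to_fract r" using x(2) bp(2) by blast
        have "to_fract (b * p) = to_fract i * to_fract p + (x * to_fract p) * to_fract j"
          using ij(3) by (simp add: algebra_simps)
        also have "\<dots> = to_fract (i * p + r * j)" by (simp add: r)
        finally have "b * p = i * p + r * j" by (simp only: to_fract_eq_iff)
        then show ?thesis using ij is_idealD[OF M(1)] by simp
      qed
      \<comment> \<open>This is \<open>q + x p = 1\<close> multiplied by \<open>a\<close>.\<close>
      have "to_fract a = to_fract a * to_fract q + (x * to_fract a) * to_fract p"
        using pq(3) by (metis (no_types, lifting) distrib_left mult.assoc mult.commute mult_1 to_fract_1)
      also have "\<dots> = to_fract (a * q + a' * p)" by (simp add: a')
      finally have eq: "a = a * q + a' * p" by (simp only: to_fract_eq_iff)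
      have "a * q + a' * p \<in> M"
        using pq by (intro is_idealD(2)[OF M(1)] mem both) simp_all
      then show "a \<in> M" by (subst eq)
    qed
    ultimately show False using M(3) by blast
  qed
  then show ?thesis using assms(3) unfolding good_def by blast
qed

section \<open>Prime avoidance\<close>

lemma ex_in_primes_notin_prime:
  fixes P :: "'a set"
  assumes "finite \<Q>" "\<And>Q. Q \<in> \<Q> \<Longrightarrow> is_prime Q \<and> Q \<noteq> {0}" "is_prime P" "P \<notin> \<Q>"
  shows "\<exists>\<epsilon>. (\<forall>Q\<in>\<Q>. \<epsilon> \<in> Q) \<and> \<epsilon> \<notin> P"
  using assms(1,2,4)
proof (induction \<Q>)
  case empty
  then show ?case using is_primeD(2)[OF assms(3)] by blast
next
  case (insert Q \<Q>)
  then obtain \<epsilon> where \<epsilon>: "\<forall>Q\<in>\<Q>. \<epsilon> \<in> Q" "\<epsilon> \<notin> P" by auto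
  \<comment> \<open>Nonzero primes are maximal, so an inclusion would force
    \<open>Q = P\<close>.\<close>
  have "\<not> Q \<subseteq> P"
    using prime_maximal[of Q P] insert.prems is_primeD[OF assms(3)] by blast
  then obtain q where q: "q \<in> Q" "q \<notin> P" by auto
  show ?case
  proof (intro exI[of _ "\<epsilon> * q"] conjI ballI)
    show "\<epsilon> * q \<notin> P" using is_primeD(3)[OF assms(3)] \<epsilon> q by blast
    show "\<epsilon> * q \<in> Q'" if "Q' \<in> insert Q \<Q>" for Q'
    proof -
      have "is_ideal Q'" using that insert.prems(1) is_primeD(1) by blast
      then show ?thesis using that \<epsilon> q is_idealD(3,4) by blast
    qed
  qed
qed

text \<open>Primes are treated one at a time, with a correction that vanishes modulo the earlier
  ones. The shift \<open>h0\<close> allows avoidance within a coset: it is 0 when a polynomial is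
  sought, and a fixed coefficient when that coefficient is moved by \<Gamma>.\<close>

lemma simultaneous_prime_avoidance:
  fixes h0 :: "'x \<Rightarrow> 'a" and G :: "('x \<Rightarrow> 'a) set"
  assumes "finite \<Q>" "\<And>Q. Q \<in> \<Q> \<Longrightarrow> is_prime Q \<and> Q \<noteq> {0}"
    and "\<And>Q. Q \<in> \<Q> \<Longrightarrow> \<exists>g\<in>G. \<exists>x. g x \<notin> Q"
    and G: "(\<lambda>_. 0) \<in> G" "\<And>g g' r. g \<in> G \<Longrightarrow> g' \<in> G \<Longrightarrow> (\<lambda>x. g x + r * g' x) \<in> G"
  shows "\<exists>g\<in>G. \<forall>Q\<in>\<Q>. \<exists>x. h0 x + g x \<notin> Q"
  using assms(1-3)
proof (induction \<Q>)
  case empty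
  then show ?case using G by auto
next
  case (insert P \<Q>)
  then obtain g where g: "g \<in> G" "\<forall>Q\<in>\<Q>. \<exists>x. h0 x + g x \<notin> Q" by (metis insertCI)
  show ?case
  proof (cases "\<exists>x. h0 x + g x \<notin> P")
    case True
    then show ?thesis using g by blast
  next
    case False
    \<comment> \<open>Here \<open>h0 + g\<close> vanishes modulo \<open>P\<close>, so adding
      \<open>\<epsilon> * g'\<close> makes it nonzero there and changes nothing modulo the primes in
      \<open>\<Q>\<close>.\<close>
    obtain g' y where g': "g' \<in> G" "g' y \<notin> P" using insert.prems(2) by blast
    have P: "is_prime P" using insert.prems(1) by blast
    obtain \<epsilon> where \<epsilon>: "\<forall>Q\<in>\<Q>. \<epsilon> \<in> Q" "\<epsilon> \<notin> P"
      using ex_in_primes_notin_prime[OF insert.hyps(1) _ P insert.hyps(2)] insert.prems(1) by blast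
    have sub: "a \<in> Q" if "is_prime Q" "a + b \<in> Q" "b \<in> Q" for a b and Q :: "'a set"
      using is_idealD(5)[OF is_primeD(1), OF that] by simp
    have "\<exists>x. h0 x + (g x + \<epsilon> * g' x) \<notin> Q" if Q: "Q \<in> insert P \<Q>" for Q
    proof (cases "Q = P")
      case True
      have "\<epsilon> * g' y \<notin> P" using is_primeD(3)[OF P] \<epsilon> g' by blast
      then have "h0 y + (g y + \<epsilon> * g' y) \<notin> P"
        using False sub[OF P, of "\<epsilon> * g' y" "h0 y + g y"] by (auto simp: algebra_simps)
      then show ?thesis using True by blast
    next
      case False
      then have "Q \<in> \<Q>" using Q by blast
      then obtain x where x: "h0 x + g x \<notin> Q" using g by blast
      have pQ: "is_prime Q" using insert.prems(1) Q by blast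
      have "\<epsilon> * g' x \<in> Q" using \<open>Q \<in> \<Q>\<close> \<epsilon>(1) is_idealD(4)[OF is_primeD(1)[OF pQ]] by blast
      then have "h0 x + (g x + \<epsilon> * g' x) \<notin> Q"
        using x sub[OF pQ, of "h0 x + g x" "\<epsilon> * g' x"] by (auto simp: algebra_simps)
      then show ?thesis by blast
    qed
    then show ?thesis by (intro bexI[OF _ G(2)[OF g(1) g'(1), of \<epsilon>]] ballI)
  qed
qed

end

section \<open>Polynomials and generalized factorials\<close>

text \<open>Both degree bounds together become one condition on the support, namely inclusion in
  this finite set (\<open>degrees_le_iff\<close>).\<close>

definition exponents :: "('n::finite \<Rightarrow> nat) \<Rightarrow> nat \<Rightarrow> ('n \<Rightarrow>\<^sub>0 nat) set"
  where "exponents m k = {e. (\<forall>i. Poly_Mapping.lookup e i \<le> m i) \<and> (\<Sum>i\<in>UNIV. Poly_Mapping.lookup e i) \<le> k}"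

definition monomial_value :: "('n::finite \<Rightarrow>\<^sub>0 nat) \<Rightarrow> ('n \<Rightarrow> 'c::comm_ring_1) \<Rightarrow> 'c"
  where "monomial_value e x = (\<Prod>i\<in>UNIV. x i ^ Poly_Mapping.lookup e i)"

definition fract_mpoly :: "('n, 'a::idom) mpoly \<Rightarrow> ('n, 'a fract) mpoly"
  where "fract_mpoly = Poly_Mapping.map to_fract"

lemma eval_mpoly_superset:
  assumes "finite E" "Poly_Mapping.keys p \<subseteq> E"
  shows "eval_mpoly p x = (\<Sum>e\<in>E. Poly_Mapping.lookup p e * monomial_value e x)"
  unfolding eval_mpoly_def monomial_value_def
  by (rule sum.mono_neutral_left) (use assms in \<open>auto simp: in_keys_iff\<close>)

lemma finite_exponents [simp]: "finite (exponents m k)"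
proof -
  have "Poly_Mapping.lookup ` exponents m k \<subseteq> (\<Pi>\<^sub>E i\<in>UNIV. {..m i})"
    by (auto simp: exponents_def)
  moreover have "finite (\<Pi>\<^sub>E i\<in>UNIV. {..m i})" by (rule finite_PiE) auto
  ultimately have "finite (Poly_Mapping.lookup ` exponents m k)" by (rule finite_subset)
  then show ?thesis by (rule finite_imageD) (simp add: inj_on_def poly_mapping_eqI)
qed

lemma zero_in_exponents [simp]: "0 \<in> exponents m k"
  by (simp add: exponents_def)

lemma degrees_le_iff:
  "partial_degrees p \<le> m \<and> total_degree p \<le> k \<longleftrightarrow> Poly_Mapping.keys p \<subseteq> exponents m k"
  by (auto simp: partial_degrees_def total_degree_def le_fun_def exponents_def)

text \<open>The given \<open>f\<close> witnesses that the bounds are attained, so a larger support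
  within the bounds has exactly the same type.\<close>

lemma of_type_mono:
  assumes "of_type f m k" "Poly_Mapping.keys f \<subseteq> Poly_Mapping.keys g" "Poly_Mapping.keys g \<subseteq> exponents m k"
  shows "of_type g m k"
proof -
  have "partial_degrees f \<le> partial_degrees g"
    unfolding le_fun_def partial_degrees_def using assms(2) by (intro allI Max_mono) auto
  moreover have "total_degree f \<le> total_degree g"
    unfolding total_degree_def using assms(2) by (intro Max_mono) auto
  moreover have "partial_degrees g \<le> m \<and> total_degree g \<le> k"
    using assms(3) by (simp only: degrees_le_iff)
  ultimately show ?thesis using assms(1) unfolding of_type_def by (metis order_antisym)
qed

lemma of_type_keys: "of_type f m k \<Longrightarrow> Poly_Mapping.keys f \<subseteq> exponents m k"
  using degrees_le_iff[of f m k] by (simp add: of_type_def)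

lemma lookup_scale [simp]:
  fixes p :: "('n, 'c::comm_ring_1) mpoly"
  shows "Poly_Mapping.lookup (Poly_Mapping.single 0 c * p) e = c * Poly_Mapping.lookup p e"
  unfolding mult_map_scale_conv_mult[symmetric] by (simp add: Poly_Mapping.map.rep_eq when_def)

lemma lookup_fract_mpoly [simp]:
  "Poly_Mapping.lookup (fract_mpoly f) e = to_fract (Poly_Mapping.lookup f e)"
  by (simp add: fract_mpoly_def Poly_Mapping.map.rep_eq when_def)

lemma keys_fract_mpoly [simp]: "Poly_Mapping.keys (fract_mpoly f) = Poly_Mapping.keys f"
  by (auto simp: in_keys_iff)

lemma keys_scale:
  fixes p :: "('n, 'c::comm_ring_1) mpoly"
  shows "Poly_Mapping.keys (Poly_Mapping.single 0 c * p) \<subseteq> Poly_Mapping.keys p"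
  by (auto simp: in_keys_iff)

lemma eval_scale [simp]:
  fixes p :: "('n::finite, 'c::comm_ring_1) mpoly"
  shows "eval_mpoly (Poly_Mapping.single 0 c * p) x = c * eval_mpoly p x"
  using eval_mpoly_superset[OF finite_keys keys_scale, of c p x] eval_mpoly_superset[OF finite_keys subset_refl, of p x]
  by (simp add: sum_distrib_left mult.assoc)

lemma to_fract_monomial_value:
  "monomial_value e (\<lambda>i. to_fract (x i)) = to_fract (monomial_value e x)"
proof -
  have pow: "to_fract (a ^ n) = to_fract a ^ n" for a :: 'a and n
    by (induction n) auto
  have "(\<Prod>i\<in>B. to_fract (x i) ^ Poly_Mapping.lookup e i) = to_fract (\<Prod>i\<in>B. x i ^ Poly_Mapping.lookup e i)" for B
    by (induction B rule: infinite_finite_induct) (auto simp: pow)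
  then show ?thesis by (simp add: monomial_value_def)
qed

lemma eval_fract_mpoly [simp]:
  "eval_mpoly (fract_mpoly f) (\<lambda>i. to_fract (x i)) = to_fract (eval_mpoly f x)"
  using eval_mpoly_superset[OF finite_keys, of "fract_mpoly f" f "\<lambda>i. to_fract (x i)"]
    eval_mpoly_superset[OF finite_keys subset_refl, of f x]
  by (simp add: to_fract_monomial_value)

section \<open>Generalized factorials, fixed divisors and primitivity\<close>

lemma gen_factorial_iff:
  "a \<in> gen_factorial S m k \<longleftrightarrow>
    (\<forall>h. Poly_Mapping.keys h \<subseteq> exponents m k \<longrightarrow>
      (\<forall>s\<in>S. eval_mpoly h (\<lambda>i. to_fract (s i)) \<in> range to_fract) \<longrightarrow>
      (\<forall>e. to_fract a * Poly_Mapping.lookup h e \<in> range to_fract))"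
  by (auto simp: gen_factorial_def Int_poly_bounded_def Int_poly_def integral_mpolys_def
      simp flip: degrees_le_iff)

lemma gen_factorial_scaleD:
  assumes "a \<in> gen_factorial S m k" "Poly_Mapping.keys h \<subseteq> exponents m k"
    and "\<And>s. s \<in> S \<Longrightarrow> u * eval_mpoly h (\<lambda>i. to_fract (s i)) \<in> range to_fract"
  shows "to_fract a * (u * Poly_Mapping.lookup h e) \<in> range to_fract"
proof -
  have "Poly_Mapping.keys (Poly_Mapping.single 0 u * h) \<subseteq> exponents m k"
    using keys_scale assms(2) by (rule subset_trans)
  moreover have "\<forall>s\<in>S. eval_mpoly (Poly_Mapping.single 0 u * h) (\<lambda>i. to_fract (s i)) \<in> range to_fract"
    using assms(3) by simp
  ultimately have "to_fract a * Poly_Mapping.lookup (Poly_Mapping.single 0 u * h) e \<in> range to_fract"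
    using assms(1) unfolding gen_factorial_iff by blast
  then show ?thesis by simp
qed

lemma is_ideal_gen_factorial: "is_ideal (gen_factorial S m k)"
proof (rule is_idealI)
  show "0 \<in> gen_factorial S m k" by (simp add: gen_factorial_iff)
  show "a + b \<in> gen_factorial S m k" if "a \<in> gen_factorial S m k" "b \<in> gen_factorial S m k" for a b
    using that unfolding gen_factorial_iff
    by (simp add: distrib_right) (blast intro: integral_add)
  show "r * a \<in> gen_factorial S m k" if "a \<in> gen_factorial S m k" for a r
    using that unfolding gen_factorial_iff
    by (simp add: mult.assoc) (blast intro: integral_mult)
qed

lemma fixed_divisor_subset_iff:
  assumes "is_ideal I"
  shows "fixed_divisor S f \<subseteq> I \<longleftrightarrow> (\<forall>s\<in>S. eval_mpoly f s \<in> I)"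
proof
  show "\<forall>s\<in>S. eval_mpoly f s \<in> I" if "fixed_divisor S f \<subseteq> I"
  proof
    fix s assume "s \<in> S"
    then have "eval_mpoly f s \<in> fixed_divisor S f"
      unfolding fixed_divisor_def by (intro subsetD[OF genideal_superset]) blast
    then show "eval_mpoly f s \<in> I" using that by blast
  qed
  show "fixed_divisor S f \<subseteq> I" if "\<forall>s\<in>S. eval_mpoly f s \<in> I"
    unfolding fixed_divisor_def using that by (intro genideal_least assms) auto
qed

text \<open>The ideal generated by the coefficients is the least one containing them. Exponents
  outside the support are harmless, since 0 lies in every ideal.\<close>

lemma primitive_mpoly_iff:
  "primitive_mpoly f \<longleftrightarrow> (\<forall>I. is_ideal I \<longrightarrow> (\<forall>e. Poly_Mapping.lookup f e \<in> I) \<longrightarrow> 1 \<in> I)"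
proof -
  have "Poly_Mapping.lookup f ` Poly_Mapping.keys f \<subseteq> I \<longleftrightarrow> (\<forall>e. Poly_Mapping.lookup f e \<in> I)"
    if "is_ideal I" for I
  proof
    assume "Poly_Mapping.lookup f ` Poly_Mapping.keys f \<subseteq> I"
    then show "\<forall>e. Poly_Mapping.lookup f e \<in> I"
      using is_idealD(1)[OF that] by (metis image_subset_iff in_keys_iff)
  qed auto
  then show ?thesis
    unfolding primitive_mpoly_def ideal_UNIV_iff[OF is_ideal_genideal] by (auto simp: genideal_RR)
qed

text \<open>Gaussian elimination on evaluations: a point \<open>s0\<close> where \<open>\<phi> e'\<close> does not vanish serves as pivot.\<close>

lemma ex_common_denominator:
  fixes \<phi> :: "'e \<Rightarrow> 's \<Rightarrow> 'a::idom"
  assumes "finite E"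
    and "\<And>c. (\<And>s. s \<in> S \<Longrightarrow> (\<Sum>e\<in>E. c e * to_fract (\<phi> e s)) = 0) \<Longrightarrow> \<forall>e\<in>E. c e = 0"
  shows "\<exists>a. a \<noteq> 0 \<and> (\<forall>c. (\<forall>s\<in>S. (\<Sum>e\<in>E. c e * to_fract (\<phi> e s)) \<in> range to_fract) \<longrightarrow>
           (\<forall>e\<in>E. to_fract a * c e \<in> range to_fract))"
  using assms
proof (induction E arbitrary: \<phi>)
  case empty
  then show ?case by (auto intro: exI[of _ 1])
next
  case (insert e' E)
  note [simp] = insert.hyps
  have ne: "e \<noteq> e'" if "e \<in> E" for e using that insert.hyps by auto
  have "\<exists>s\<in>S. \<phi> e' s \<noteq> 0"
  proof (rule ccontr)
    assume "\<not> ?thesis"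
    then have "\<forall>e\<in>insert e' E. (if e = e' then 1 else 0) = (0 :: 'a fract)"
      by (intro insert.prems) (auto intro!: sum.neutral dest: ne)
    then show False by auto
  qed
  then obtain s0 where s0: "s0 \<in> S" "\<phi> e' s0 \<noteq> 0" by blast
  \<comment> \<open>Elimination of \<open>e'\<close> with the pivot at \<open>s0\<close>: the
    combination vanishes at \<open>s0\<close> and would be zero for \<open>e = e'\<close>.\<close>
  define \<psi> where "\<psi> e s = \<phi> e s * \<phi> e' s0 - \<phi> e s0 * \<phi> e' s" for e s
  have sum_\<psi>: "(\<Sum>e\<in>E. c e * to_fract (\<psi> e s)) =
      to_fract (\<phi> e' s0) * (\<Sum>e\<in>E. c e * to_fract (\<phi> e s)) - (\<Sum>e\<in>E. c e * to_fract (\<phi> e s0)) * to_fract (\<phi> e' s)"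
    for c s
    unfolding \<psi>_def sum_distrib_left sum_distrib_right sum_subtractf[symmetric]
    by (rule sum.cong) (simp_all add: algebra_simps)
  have "\<exists>a. a \<noteq> 0 \<and> (\<forall>c. (\<forall>s\<in>S. (\<Sum>e\<in>E. c e * to_fract (\<psi> e s)) \<in> range to_fract) \<longrightarrow>
           (\<forall>e\<in>E. to_fract a * c e \<in> range to_fract))"
  proof (rule insert.IH)
    fix c assume c: "\<And>s. s \<in> S \<Longrightarrow> (\<Sum>e\<in>E. c e * to_fract (\<psi> e s)) = 0"
    \<comment> \<open>The entry at \<open>e'\<close> is chosen so that evaluating \<open>c'\<close>
      with \<open>\<phi>\<close> at any \<open>s\<close> gives the evaluation of \<open>c\<close>
      with \<open>\<psi>\<close>.\<close>
    define c' where "c' e = (if e = e' then - (\<Sum>e\<in>E. c e * to_fract (\<phi> e s0)) else to_fract (\<phi> e' s0) * c e)" for e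
    have "\<forall>e\<in>insert e' E. c' e = 0"
    proof (rule insert.prems)
      fix s assume "s \<in> S"
      have "(\<Sum>e\<in>E. c' e * to_fract (\<phi> e s)) = to_fract (\<phi> e' s0) * (\<Sum>e\<in>E. c e * to_fract (\<phi> e s))"
        unfolding sum_distrib_left by (rule sum.cong) (auto simp: c'_def mult.assoc dest: ne)
      then show "(\<Sum>e\<in>insert e' E. c' e * to_fract (\<phi> e s)) = 0"
        using c[OF \<open>s \<in> S\<close>] by (simp add: sum_\<psi> c'_def[of e'])
    qed
    then show "\<forall>e\<in>E. c e = 0" using s0 ne by (auto simp: c'_def)
  qed
  then obtain a where a: "a \<noteq> 0" "\<And>c e. (\<And>s. s \<in> S \<Longrightarrow> (\<Sum>e\<in>E. c e * to_fract (\<psi> e s)) \<in> range to_fract) \<Longrightarrow>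
           e \<in> E \<Longrightarrow> to_fract a * c e \<in> range to_fract"
    by blast
  \<comment> \<open>The factor \<open>a\<close> clears the coefficients over \<open>E\<close>. The
    extra factor \<open>\<phi> e' s0\<close> clears \<open>c e'\<close>, which is recovered from the
    value at \<open>s0\<close>.\<close>
  show ?case
  proof (intro exI[of _ "a * \<phi> e' s0"] conjI allI impI ballI)
    show "a * \<phi> e' s0 \<noteq> 0" using a s0 by simp
    fix c e assume c: "\<forall>s\<in>S. (\<Sum>e\<in>insert e' E. c e * to_fract (\<phi> e s)) \<in> range to_fract"
      and e: "e \<in> insert e' E"
    have E: "to_fract a * c e \<in> range to_fract" if "e \<in> E" for e
    proof (rule a(2)[OF _ that])
      fix s assume s: "s \<in> S"
      have "(\<Sum>e\<in>E. c e * to_fract (\<psi> e s)) =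
          to_fract (\<phi> e' s0) * (\<Sum>e\<in>insert e' E. c e * to_fract (\<phi> e s)) -
          (\<Sum>e\<in>insert e' E. c e * to_fract (\<phi> e s0)) * to_fract (\<phi> e' s)"
        by (simp add: sum_\<psi> algebra_simps)
      then show "(\<Sum>e\<in>E. c e * to_fract (\<psi> e s)) \<in> range to_fract"
        using c s s0(1) by (auto intro!: integral_diff integral_mult simp del: sum.insert)
    qed
    have "to_fract (a * \<phi> e' s0) * c e' =
      to_fract a * (\<Sum>e\<in>insert e' E. c e * to_fract (\<phi> e s0)) - (\<Sum>e\<in>E. (to_fract a * c e) * to_fract (\<phi> e s0))"
      by (simp add: algebra_simps sum_distrib_left)
    also have "\<dots> \<in> range to_fract"
      using bspec[OF c s0(1)] by (intro integral_diff integral_mult[OF rangeI] integral_sum[OF integral_mult[OF E rangeI]])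
    finally have "to_fract (a * \<phi> e' s0) * c e' \<in> range to_fract" .
    moreover have "to_fract (a * \<phi> e' s0) * c e \<in> range to_fract" if "e \<in> E"
      using integral_mult[OF E[OF that] rangeI[of to_fract "\<phi> e' s0"]] by (simp add: mult_ac)
    ultimately show "to_fract (a * \<phi> e' s0) * c e \<in> range to_fract" using e by auto
  qed
qed

section \<open>Divisibility and sharpness over a Dedekind domain\<close>

context dedekind
begin

text \<open>All multiples of \<open>h\<close> by scalars from \<open>K\<close> are integer-valued.
  For \<open>a \<noteq> 0\<close> one of them, after multiplication by \<open>a\<close>, has the
  coefficient \<open>1 / t\<close> with a nonunit \<open>t\<close>, which is not in
  \<open>R\<close>.\<close>

lemma gen_factorial_eq_0:
  fixes S :: "('n::finite \<Rightarrow> 'a) set"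
  assumes h: "h \<noteq> 0" "Poly_Mapping.keys h \<subseteq> exponents m k"
    "\<forall>s\<in>S. eval_mpoly h (\<lambda>i. to_fract (s i)) = 0"
  shows "gen_factorial S m k = {0}"
proof -
  have "a = 0" if a: "a \<in> gen_factorial S m k" for a
  proof (rule ccontr)
    assume "a \<noteq> 0"
    obtain t :: 'a where t: "t \<noteq> 0" "\<not> t dvd 1" using ex_nonunit by blast
    obtain e where e: "Poly_Mapping.lookup h e \<noteq> 0" using h(1) by (metis poly_mapping_eqI lookup_zero)
    define u where "u = 1 / (to_fract t * to_fract a * Poly_Mapping.lookup h e)"
    have "to_fract a * (u * Poly_Mapping.lookup h e) \<in> range to_fract"
      using h(3) by (intro gen_factorial_scaleD[OF a h(2)]) simp
    moreover have "to_fract a * (u * Poly_Mapping.lookup h e) = 1 / to_fract t"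
      using e \<open>a \<noteq> 0\<close> t by (simp add: u_def field_simps)
    ultimately obtain r where "1 / to_fract t = to_fract r" by auto
    then have "to_fract (t * r) = to_fract 1" using t by (simp add: field_simps)
    then have "t * r = 1" by (simp only: to_fract_eq_iff)
    then show False using t(2) by (metis dvd_triv_left)
  qed
  then show ?thesis using is_idealD(1)[OF is_ideal_gen_factorial] by blast
qed

theorem gen_factorial_subset_fixed_divisor:
  fixes S :: "('n::finite \<Rightarrow> 'a) set"
  assumes f: "primitive_mpoly f" "Poly_Mapping.keys f \<subseteq> exponents m k"
  shows "gen_factorial S m k \<subseteq> fixed_divisor S f"
proof -
  have id: "is_ideal (fixed_divisor S f)"
    unfolding fixed_divisor_def by (rule is_ideal_genideal)
  have in_fd: "eval_mpoly f s \<in> fixed_divisor S f" if "s \<in> S" for s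
    using fixed_divisor_subset_iff[OF id, of S f] that by blast
  show ?thesis
  proof (cases "fixed_divisor S f = {0}")
    \<comment> \<open>Divisoriality concerns nonzero ideals only. If the fixed divisor is 0, then
      \<open>f\<close> itself vanishes on \<open>S\<close> and forces \<Gamma> to be 0.\<close>
    case True
    have "f \<noteq> 0"
      using f(1) unfolding primitive_mpoly_iff by (auto dest!: spec[of _ "{0}"] simp: is_ideal_def)
    then have "fract_mpoly f \<noteq> 0"
      by (metis keys_fract_mpoly keys_eq_empty)
    then have "gen_factorial S m k = {0}"
      using f(2) in_fd True by (intro gen_factorial_eq_0[of "fract_mpoly f"]) auto
    then show ?thesis using True by simp
  next
    case False
    show ?thesis
    proof
      fix a assume a: "a \<in> gen_factorial S m k"
      show "a \<in> fixed_divisor S f"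
      proof (rule divisorial[OF id False])
        fix x assume x: "\<And>i. i \<in> fixed_divisor S f \<Longrightarrow> x * to_fract i \<in> range to_fract"
        have h: "to_fract a * (x * to_fract (Poly_Mapping.lookup f e)) \<in> range to_fract" for e
          using gen_factorial_scaleD[OF a, of "fract_mpoly f" x e] f(2) x in_fd by simp
        \<comment> \<open>The elements that \<open>x * a\<close> carries into \<open>R\<close> form
          an ideal containing all coefficients of \<open>f\<close>; primitivity puts 1 into
          it.\<close>
        let ?J = "{r. x * to_fract a * to_fract r \<in> range to_fract}"
        have "is_ideal ?J"
        proof (rule is_idealI)
          show "0 \<in> ?J" by simp
          show "b + c \<in> ?J" if "b \<in> ?J" "c \<in> ?J" for b c
            using that by (auto simp: distrib_left intro: integral_add)
          show "r * b \<in> ?J" if "b \<in> ?J" for r b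
            using integral_mult[OF rangeI[of to_fract r], of "x * to_fract a * to_fract b"] that
            by (simp add: mult_ac)
        qed
        moreover have "\<forall>e. Poly_Mapping.lookup f e \<in> ?J" using h by (simp add: mult_ac)
        ultimately have "1 \<in> ?J" using f(1) unfolding primitive_mpoly_iff by blast
        then show "x * to_fract a \<in> range to_fract" by simp
      qed
    qed
  qed
qed

text \<open>Without vanishing polynomials, the values on \<open>S\<close> determine the
  coefficients, and \<open>ex_common_denominator\<close> bounds the denominators of all
  integer-valued polynomials at once.\<close>

lemma gen_factorial_nonzero:
  fixes S :: "('n::finite \<Rightarrow> 'a) set"
  assumes "\<not> (\<exists>h. h \<noteq> 0 \<and> Poly_Mapping.keys h \<subseteq> exponents m k \<and>
      (\<forall>s\<in>S. eval_mpoly h (\<lambda>i. to_fract (s i)) = 0))"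
  shows "gen_factorial S m k \<noteq> {0}"
proof -
  let ?E = "exponents m k"
  have "\<exists>a. a \<noteq> 0 \<and> (\<forall>c. (\<forall>s\<in>S. (\<Sum>e\<in>?E. c e * to_fract (monomial_value e s)) \<in> range to_fract) \<longrightarrow>
           (\<forall>e\<in>?E. to_fract a * c e \<in> range to_fract))"
  proof (rule ex_common_denominator[OF finite_exponents])
    fix c assume c: "\<And>s. s \<in> S \<Longrightarrow> (\<Sum>e\<in>?E. c e * to_fract (monomial_value e s)) = 0"
    define h where "h = Abs_poly_mapping (\<lambda>e. c e when e \<in> ?E)"
    have lookup: "Poly_Mapping.lookup h e = (c e when e \<in> ?E)" for e
      unfolding h_def by (subst lookup_Abs_poly_mapping) (auto intro: finite_subset[OF _ finite_exponents[of m k]])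
    have keys: "Poly_Mapping.keys h \<subseteq> ?E" by (auto simp: in_keys_iff lookup)
    have "eval_mpoly h (\<lambda>i. to_fract (s i)) = 0" if "s \<in> S" for s
      using c[OF that] by (simp add: eval_mpoly_superset[OF finite_exponents keys] lookup to_fract_monomial_value)
    then have "h = 0" using assms keys by blast
    then show "\<forall>e\<in>?E. c e = 0" using lookup by (metis lookup_zero when_simps(1))
  qed
  then obtain a where a: "a \<noteq> 0"
    "\<And>c e. (\<forall>s\<in>S. (\<Sum>e\<in>?E. c e * to_fract (monomial_value e s)) \<in> range to_fract) \<Longrightarrow>
           e \<in> ?E \<Longrightarrow> to_fract a * c e \<in> range to_fract"
    by blast
  have "a \<in> gen_factorial S m k" unfolding gen_factorial_iff
  proof (intro allI impI)
    fix h e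
    assume keys: "Poly_Mapping.keys h \<subseteq> ?E"
      and "\<forall>s\<in>S. eval_mpoly h (\<lambda>i. to_fract (s i)) \<in> range to_fract"
    then have "\<forall>s\<in>S. (\<Sum>e\<in>?E. Poly_Mapping.lookup h e * to_fract (monomial_value e s)) \<in> range to_fract"
      by (simp add: eval_mpoly_superset[OF finite_exponents keys] to_fract_monomial_value)
    then have "e \<in> ?E \<Longrightarrow> to_fract a * Poly_Mapping.lookup h e \<in> range to_fract" by (rule a(2))
    moreover have "e \<notin> ?E \<Longrightarrow> Poly_Mapping.lookup h e = 0" using keys by (auto simp: in_keys_iff)
    ultimately show "to_fract a * Poly_Mapping.lookup h e \<in> range to_fract" by (cases "e \<in> ?E") auto
  qed
  then show ?thesis using a(1) by blast
qed

lemma ex_eval_in_gen_factorial_notin_prime: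
  fixes S :: "('n::finite \<Rightarrow> 'a) set"
  assumes nz: "gen_factorial S m k \<noteq> {0}"
    and P: "is_prime P" "gen_factorial S m k \<subseteq> P"
  shows "\<exists>g. Poly_Mapping.keys g \<subseteq> exponents m k \<and> (\<forall>s\<in>S. eval_mpoly g s \<in> gen_factorial S m k) \<and>
    (\<exists>e. Poly_Mapping.lookup g e \<notin> P)"
proof (rule ccontr)
  assume "\<not> ?thesis"
  then have all: "Poly_Mapping.lookup g e \<in> P"
    if "Poly_Mapping.keys g \<subseteq> exponents m k" "\<forall>s\<in>S. eval_mpoly g s \<in> gen_factorial S m k" for g e
    using that by blast
  let ?\<Gamma> = "gen_factorial S m k"
  note id = is_ideal_gen_factorial[of S m k]
  have "P \<noteq> {0}" using nz P is_idealD(1)[OF id] by blast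
  then obtain x where x: "x \<notin> range to_fract" "\<And>p. p \<in> P \<Longrightarrow> x * to_fract p \<in> range to_fract"
    using prime_inverse[OF P(1)] by blast
  have "x \<in> range to_fract"
  proof (rule stabilizer_integral[OF id nz])
    fix a assume a: "a \<in> ?\<Gamma>"
    obtain b where b: "x * to_fract a = to_fract b" using x(2) a P(2) by blast
    have "b \<in> ?\<Gamma>" unfolding gen_factorial_iff
    proof (intro allI impI)
      fix h e
      assume h: "Poly_Mapping.keys h \<subseteq> exponents m k"
        "\<forall>s\<in>S. eval_mpoly h (\<lambda>i. to_fract (s i)) \<in> range to_fract"
      have ah: "\<And>e. to_fract a * Poly_Mapping.lookup h e \<in> range to_fract"
        using a h unfolding gen_factorial_iff by blast
      then obtain c where c: "\<And>e. to_fract a * Poly_Mapping.lookup h e = to_fract (c e)"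
        unfolding image_iff by metis
      \<comment> \<open>\<open>g\<close> is \<open>a h\<close> read over \<open>R\<close>. Its
        values are multiples of \<open>a\<close>, hence in \<Gamma>, so by assumption its
        coefficients lie in \<open>P\<close> and \<open>x\<close> keeps them integral.\<close>
      define g where "g = Abs_poly_mapping c"
      have "{e. c e \<noteq> 0} \<subseteq> Poly_Mapping.keys h"
        using c by (auto simp: in_keys_iff) (metis mult_zero_right to_fract_eq_0_iff)
      then have "finite {e. c e \<noteq> 0}" by (rule finite_subset) simp
      then have lookup: "Poly_Mapping.lookup g = c" unfolding g_def by (rule lookup_Abs_poly_mapping)
      have gh: "fract_mpoly g = Poly_Mapping.single 0 (to_fract a) * h"
        by (rule poly_mapping_eqI) (simp add: lookup c)
      have keys: "Poly_Mapping.keys g \<subseteq> exponents m k"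
        using keys_scale[of "to_fract a" h] h(1) by (simp flip: gh)
      have "Poly_Mapping.lookup g e \<in> P"
      proof (rule all[OF keys], rule ballI)
        fix s assume "s \<in> S"
        then obtain r where r: "eval_mpoly h (\<lambda>i. to_fract (s i)) = to_fract r" using h(2) by blast
        have "to_fract (eval_mpoly g s) = to_fract (a * r)"
          unfolding eval_fract_mpoly[symmetric] gh by (simp add: r)
        then have "eval_mpoly g s = a * r" by (simp only: to_fract_eq_iff)
        then show "eval_mpoly g s \<in> ?\<Gamma>" using is_idealD(4)[OF id a] by simp
      qed
      then have "x * to_fract (c e) \<in> range to_fract" using x(2) lookup by simp
      then show "to_fract b * Poly_Mapping.lookup h e \<in> range to_fract"
        by (simp flip: b c add: mult.assoc)
    qed
    then show "x * to_fract a \<in> to_fract ` ?\<Gamma>" using b by simp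
  qed
  then show False using x(1) by blast
qed

text \<open>The exponent \<open>e1\<close> provides a coefficient that can be moved while the
  constant one stays fixed; \<open>f\<close> ensures that the type can be attained.\<close>

lemma ex_primitive_fixed_divisor_eq:
  fixes S :: "('n::finite \<Rightarrow> 'a) set"
  assumes nz: "gen_factorial S m k \<noteq> {0}"
    and f: "of_type f m k" and e1: "e1 \<in> exponents m k" "e1 \<noteq> 0"
  shows "\<exists>g. primitive_mpoly g \<and> of_type g m k \<and> fixed_divisor S g = gen_factorial S m k"
proof -
  let ?\<Gamma> = "gen_factorial S m k" and ?E = "exponents m k"
  note id = is_ideal_gen_factorial[of S m k]
  obtain \<gamma> where \<gamma>: "\<gamma> \<in> ?\<Gamma>" "\<gamma> \<noteq> 0" using nz id ideal_nonzero_iff by blast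
  \<comment> \<open>Polynomials appear as coefficient functions, the form that
    \<open>simultaneous_prime_avoidance\<close> expects.\<close>
  define G where "G = {g. (\<forall>e. e \<notin> ?E \<longrightarrow> g e = 0) \<and> (\<forall>s\<in>S. (\<Sum>e\<in>?E. g e * monomial_value e s) \<in> ?\<Gamma>)}"
  have sum_\<Gamma>: "sum u B \<in> ?\<Gamma>" if "\<And>e. e \<in> B \<Longrightarrow> u e \<in> ?\<Gamma>" for u :: "('n \<Rightarrow>\<^sub>0 nat) \<Rightarrow> 'a" and B
    using that by (induction B rule: infinite_finite_induct) (auto intro: is_idealD[OF id])
  have "\<exists>h\<in>G. \<forall>P\<in>{P. is_prime P \<and> ?\<Gamma> \<subseteq> P}. \<exists>e. 0 + h e \<notin> P"
  proof (rule simultaneous_prime_avoidance)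
    show "finite {P. is_prime P \<and> ?\<Gamma> \<subseteq> P}"
      by (rule finite_subset[OF _ finite_primes_containing[OF \<gamma>(2)]]) (use \<gamma> in auto)
    show "is_prime P \<and> P \<noteq> {0}" if "P \<in> {P. is_prime P \<and> ?\<Gamma> \<subseteq> P}" for P
      using that \<gamma> by auto
    show "\<exists>g\<in>G. \<exists>e. g e \<notin> P" if "P \<in> {P. is_prime P \<and> ?\<Gamma> \<subseteq> P}" for P
    proof -
      have "is_prime P" "?\<Gamma> \<subseteq> P" using that by auto
      then obtain g e where g: "Poly_Mapping.keys g \<subseteq> ?E" "\<forall>s\<in>S. eval_mpoly g s \<in> ?\<Gamma>"
          "Poly_Mapping.lookup g e \<notin> P"
        using ex_eval_in_gen_factorial_notin_prime[OF nz] by blast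
      have "Poly_Mapping.lookup g \<in> G"
        using g(1,2) by (auto simp: G_def eval_mpoly_superset[OF finite_exponents g(1)] in_keys_iff)
      then show ?thesis using g(3) by blast
    qed
    show "(\<lambda>_. 0) \<in> G" using is_idealD(1)[OF id] by (simp add: G_def)
    show "(\<lambda>e. g e + r * g' e) \<in> G" if "g \<in> G" "g' \<in> G" for g g' r
      using that is_idealD(2,3)[OF id]
      by (simp add: G_def distrib_right sum.distrib mult.assoc flip: sum_distrib_left)
  qed
  then obtain h where h: "h \<in> G" "\<And>P. is_prime P \<Longrightarrow> ?\<Gamma> \<subseteq> P \<Longrightarrow> \<exists>e. h e \<notin> P" by auto
  \<comment> \<open>Filling the gaps with \<open>\<gamma>\<close> gives full support and preserves
    all coefficients modulo \<Gamma>.\<close>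
  define h' where "h' e = (if e \<in> ?E \<and> h e = 0 then \<gamma> else h e)" for e
  have h'_nz: "h' e \<noteq> 0" if "e \<in> ?E" for e using that \<gamma> by (simp add: h'_def)
  \<comment> \<open>Only these primes can still contain all coefficients. They are finitely many
    because \<open>h' 0 \<noteq> 0\<close>.\<close>
  let ?Q = "{P. is_prime P \<and> h' 0 \<in> P \<and> \<not> ?\<Gamma> \<subseteq> P}"
  have "\<exists>t\<in>?\<Gamma>. h' e1 + t \<noteq> 0 \<and> (\<forall>P\<in>?Q. h' e1 + t \<notin> P)"
  \<comment> \<open>A value outside some prime is automatically nonzero; with no prime to avoid,
    \<open>t = 0\<close> keeps the coefficient nonzero.\<close>
  proof (cases "?Q = {}")
    case True
    then show ?thesis using is_idealD(1)[OF id] h'_nz[OF e1(1)]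
      by (intro bexI[of _ 0] conjI) (simp, blast, simp)
  next
    case False
    \<comment> \<open>A single coefficient is treated as a function on \<open>unit\<close>, and
      \<Gamma> as a set of constant functions.\<close>
    have "\<exists>g\<in>(\<lambda>t _. t) ` ?\<Gamma>. \<forall>P\<in>?Q. \<exists>x::unit. h' e1 + g x \<notin> P"
    proof (rule simultaneous_prime_avoidance)
      show "finite ?Q"
        by (rule finite_subset[OF _ finite_primes_containing[OF h'_nz[OF zero_in_exponents]]]) auto
      show "is_prime P \<and> P \<noteq> {0}" if "P \<in> ?Q" for P
        using that h'_nz[OF zero_in_exponents] by auto
      show "\<exists>g\<in>(\<lambda>t _. t) ` ?\<Gamma>. \<exists>x::unit. g x \<notin> P" if "P \<in> ?Q" for P
        using that by auto
      show "(\<lambda>_. 0) \<in> (\<lambda>t _. t) ` ?\<Gamma>" using is_idealD(1)[OF id] by blast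
      show "(\<lambda>x. g x + r * g' x) \<in> (\<lambda>t _. t) ` ?\<Gamma>"
        if "g \<in> (\<lambda>t _. t) ` ?\<Gamma>" "g' \<in> (\<lambda>t _. t) ` ?\<Gamma>" for g g' :: "unit \<Rightarrow> 'a" and r
        using that is_idealD(2,3)[OF id] by auto
    qed
    then obtain t where t: "t \<in> ?\<Gamma>" "\<forall>P\<in>?Q. h' e1 + t \<notin> P" by auto
    moreover have "h' e1 + t \<noteq> 0" using False t(2) is_idealD(1)[OF is_primeD(1)] by fastforce
    ultimately show ?thesis by blast
  qed
  then obtain t where t: "t \<in> ?\<Gamma>" "h' e1 + t \<noteq> 0" "\<And>P. P \<in> ?Q \<Longrightarrow> h' e1 + t \<notin> P" by blast
  define c where "c = h'(e1 := h' e1 + t)"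
  have diff: "c e - h e \<in> ?\<Gamma>" for e
  proof -
    have "h' e - h e \<in> ?\<Gamma>" using \<gamma>(1) is_idealD(1)[OF id] by (simp add: h'_def)
    then have "h' e - h e + t \<in> ?\<Gamma>" "h' e - h e \<in> ?\<Gamma>" using t(1) is_idealD(2)[OF id] by blast+
    then show ?thesis by (cases "e = e1") (simp_all add: c_def algebra_simps)
  qed
  have c_nz: "c e \<noteq> 0 \<longleftrightarrow> e \<in> ?E" for e
    using h(1) h'_nz t(2) e1 by (auto simp: c_def h'_def G_def)
  define g where "g = Abs_poly_mapping c"
  have lookup: "Poly_Mapping.lookup g = c"
    unfolding g_def by (rule lookup_Abs_poly_mapping) (simp add: c_nz)
  have keys: "Poly_Mapping.keys g = ?E" by (auto simp: in_keys_iff lookup c_nz)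
  have prim: "primitive_mpoly g" unfolding primitive_mpoly_iff lookup
  proof (intro allI impI, rule ccontr)
    fix I :: "'a set" assume I: "is_ideal I" "\<forall>e. c e \<in> I" "1 \<notin> I"
    then obtain P where P: "is_prime P" "I \<subseteq> P" using prime_superset by blast
    show False
    \<comment> \<open>Above \<Gamma> the coefficients of \<open>g\<close> and \<open>h\<close> agree
      modulo \<open>P\<close>, and \<open>h\<close> is nonzero there. Any other prime containing
      \<open>c 0 = h' 0\<close> belongs to \<open>?Q\<close> and misses \<open>c e1\<close>.\<close>
    proof (cases "?\<Gamma> \<subseteq> P")
      case True
      then obtain e where "h e \<notin> P" using h(2)[OF P(1)] by blast
      moreover have "c e - (c e - h e) \<in> P"
      proof (rule is_idealD(5)[OF is_primeD(1)[OF P(1)]])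
        show "c e \<in> P" using I(2) P(2) by blast
        show "c e - h e \<in> P" using diff True by blast
      qed
      ultimately show False by simp
    next
      case False
      have "c 0 \<in> P" "c e1 \<in> P" using I(2) P(2) by auto
      then show False using t(3)[of P] False P(1) e1(2) by (simp add: c_def)
    qed
  qed
  have "eval_mpoly g s \<in> ?\<Gamma>" if "s \<in> S" for s
  proof -
    have "(\<Sum>e\<in>?E. h e * monomial_value e s) + (\<Sum>e\<in>?E. (c e - h e) * monomial_value e s) \<in> ?\<Gamma>"
    proof (rule is_idealD(2)[OF id])
      show "(\<Sum>e\<in>?E. h e * monomial_value e s) \<in> ?\<Gamma>" using h(1) that by (simp add: G_def)
      show "(\<Sum>e\<in>?E. (c e - h e) * monomial_value e s) \<in> ?\<Gamma>"
        by (intro sum_\<Gamma> is_idealD(4)[OF id] diff)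
    qed
    then show ?thesis
      by (simp add: eval_mpoly_superset[OF finite_exponents equalityD1[OF keys]] lookup
          flip: sum.distrib distrib_right)
  qed
  then have "fixed_divisor S g \<subseteq> ?\<Gamma>" by (simp add: fixed_divisor_subset_iff[OF id])
  moreover have "?\<Gamma> \<subseteq> fixed_divisor S g"
    by (rule gen_factorial_subset_fixed_divisor[OF prim equalityD1[OF keys]])
  moreover have "of_type g m k"
    by (rule of_type_mono[OF f]) (use of_type_keys[OF f] keys in auto)
  ultimately show ?thesis using prim by blast
qed

text \<open>When the bounds admit constants only, there is no coefficient to move. Integer-valued
  constants already lie in \<open>R\<close> as \<open>S\<close> is nonempty, so \<Gamma> is the
  whole ring and divisibility gives equality.\<close>

lemma fixed_divisor_constants:
  fixes S :: "('n::finite \<Rightarrow> 'a) set"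
  assumes "primitive_mpoly f" "Poly_Mapping.keys f \<subseteq> exponents m k"
    and E: "exponents m k = {0}" and "S \<noteq> {}"
  shows "fixed_divisor S f = gen_factorial S m k"
proof -
  have eval: "eval_mpoly h x = Poly_Mapping.lookup h 0" if "Poly_Mapping.keys h \<subseteq> exponents m k"
    for h :: "('n, 'c::comm_ring_1) mpoly" and x
    using eval_mpoly_superset[OF finite_exponents that, of x] by (simp add: E monomial_value_def)
  have "1 \<in> gen_factorial S m k" unfolding gen_factorial_iff
  proof (intro allI impI)
    fix h e
    assume h: "Poly_Mapping.keys h \<subseteq> exponents m k"
      "\<forall>s\<in>S. eval_mpoly h (\<lambda>i. to_fract (s i)) \<in> range to_fract"
    then have "Poly_Mapping.lookup h 0 \<in> range to_fract" using \<open>S \<noteq> {}\<close> by (auto simp: eval[OF h(1)])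
    moreover have "Poly_Mapping.lookup h e = 0" if "e \<noteq> 0"
      using that h(1) E by (auto simp: in_keys_iff)
    ultimately show "to_fract 1 * Poly_Mapping.lookup h e \<in> range to_fract" by (cases "e = 0") auto
  qed
  then have "gen_factorial S m k = UNIV" using ideal_UNIV_iff[OF is_ideal_gen_factorial] by blast
  then show ?thesis using gen_factorial_subset_fixed_divisor[OF assms(1,2), of S] by blast
qed

end

text \<open>If a nonzero polynomial within the bounds vanishes on \<open>S\<close>, then \<Gamma> is
  0, and \<open>g\<close> attains it exactly when \<open>g\<close> vanishes on \<open>S\<close>. The
  premise of the sharpness claim asks for such a primitive polynomial of the right type in this
  case, and holds vacuously otherwise.\<close>

theorem theorem2p2:
  fixes S :: "('n::finite \<Rightarrow> 'a::idom) set"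
    and m :: "'n \<Rightarrow> nat" and k :: nat
    and f :: "('n, 'a) mpoly"
  assumes "dedekind_domain TYPE('a)"
    and "primitive_mpoly f" and "of_type f m k"
  shows "ideal_divides (fixed_divisor S f) (gen_factorial S m k) \<and>
    (((\<exists>h :: ('n, 'a fract) mpoly. h \<noteq> 0 \<and> partial_degrees h \<le> m \<and> total_degree h \<le> k \<and>
          (\<forall>s\<in>S. eval_mpoly h (\<lambda>i. to_fract (s i)) = 0))
        \<longrightarrow> (\<exists>h :: ('n, 'a) mpoly. primitive_mpoly h \<and> of_type h m k \<and>
              (\<forall>s\<in>S. eval_mpoly h s = 0)))
      \<longrightarrow> (\<exists>g :: ('n, 'a) mpoly. primitive_mpoly g \<and> of_type g m k \<and>
            fixed_divisor S g = gen_factorial S m k))"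
proof -
  interpret dedekind "TYPE('a)" by unfold_locales (rule assms(1))
  note keys = of_type_keys[OF assms(3)]
  let ?V = "\<lambda>h :: ('n, 'a fract) mpoly. h \<noteq> 0 \<and> Poly_Mapping.keys h \<subseteq> exponents m k \<and>
    (\<forall>s\<in>S. eval_mpoly h (\<lambda>i. to_fract (s i)) = 0)"
  have divides: "gen_factorial S m k \<subseteq> fixed_divisor S f"
    using gen_factorial_subset_fixed_divisor assms(2) keys by blast
  have "\<exists>g. primitive_mpoly g \<and> of_type g m k \<and> fixed_divisor S g = gen_factorial S m k"
    if vanishing: "\<exists>h. ?V h \<Longrightarrow> \<exists>h :: ('n, 'a) mpoly. primitive_mpoly h \<and> of_type h m k \<and>
              (\<forall>s\<in>S. eval_mpoly h s = 0)"
  proof (cases "\<exists>h. ?V h")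
    case True
    then have \<Gamma>: "gen_factorial S m k = {0}" using gen_factorial_eq_0 by blast
    obtain g :: "('n, 'a) mpoly" where g: "primitive_mpoly g" "of_type g m k" "\<forall>s\<in>S. eval_mpoly g s = 0"
      using vanishing[OF True] by blast
    have "fixed_divisor S g \<subseteq> gen_factorial S m k"
      using g(3) is_idealD(1)[OF is_ideal_gen_factorial[of S m k]]
      by (simp add: fixed_divisor_subset_iff[OF is_ideal_gen_factorial])
    moreover have "gen_factorial S m k \<subseteq> fixed_divisor S g"
      using gen_factorial_subset_fixed_divisor[OF g(1) of_type_keys[OF g(2)]] .
    ultimately show ?thesis using g by blast
  next
    case False
    show ?thesis
    proof (cases "exponents m k = {0}")
      case True
      \<comment> \<open>On an empty \<open>S\<close> the constant 1 vanishes vacuously, so the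
        present case forces \<open>S\<close> to be nonempty.\<close>
      have "?V (Poly_Mapping.single 0 1)" if "S = {}"
        using that by (auto simp: single_one)
      then have "S \<noteq> {}" using False by blast
      then show ?thesis
        using fixed_divisor_constants[OF assms(2) keys True] assms(2,3) by blast
    next
      case nontrivial: False
      then obtain e1 where "e1 \<in> exponents m k" "e1 \<noteq> 0"
        using zero_in_exponents by blast
      then show ?thesis
        using ex_primitive_fixed_divisor_eq[OF gen_factorial_nonzero[OF False] assms(3)] by blast
    qed
  qed
  moreover have "?V h \<longleftrightarrow> h \<noteq> 0 \<and> partial_degrees h \<le> m \<and> total_degree h \<le> k \<and>
      (\<forall>s\<in>S. eval_mpoly h (\<lambda>i. to_fract (s i)) = 0)" for h
    by (simp flip: degrees_le_iff)
  ultimately show ?thesis using divides unfolding ideal_divides_def by presburger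
qed

end
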